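(* For $0<c<\frac13$ let $$\varphi_c(w)=-\frac1w+\frac{4c}{1-cw}-\frac{4c}{1+cw},\qquad w\in\mathbb{D}=\{|w|<1\}.$$ Then $\varphi_c$ is univalent on $\mathbb{D}$ (with $\varphi_c(0)=\infty$). Let $\Omega_c=\varphi_c(\mathbb{D})$. The droplet whose complement is $\Omega_c$ satisfies $$G_c(z)=p\,\bar z+i\tau\,\dot{\bar z}$$ at every point $z$ of its boundary, where $p=1-c^4$, $\tau=6c^4+2$, and $G_c$ is the function given in the local variable $w=\varphi_c^{-1}(z)$ by $$G_c(\varphi_c(w))=\hat G_c(w)=(9c^4-1)\,\frac{w\,(3+c^2w^2)}{1+3c^2w^2}.$$ Furthermore, the droplet is convex for $0<c\le c_1:=\frac{\sqrt{6\sqrt{13}-21}}{3}=0.265\ldots$.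
   Context: A droplet is the complement in the Riemann sphere of a simply connected domain $\Omega$ containing $\infty$; here $\Omega=\Omega_c$, and $\varphi_c$ is its conformal parametrization from the unit disc, extended to $|w|=1$ by the same formula, so that the boundary of the droplet is the curve $\varphi_c(\partial\mathbb{D})$. The dot denotes the derivative with respect to arc length along the boundary of the droplet, traversed counterclockwise (positively oriented as the boundary of the droplet); thus $\dot{\bar z}$ is the complex conjugate of the unit tangent $\dot z$ at $z$. *)

theory Defs
  imports "HOL-Complex_Analysis.Complex_Analysis"
begin

text \<open>In the type \<^typ>\<open>complex option\<close>, \<^term>\<open>None\<close> is the point at infinity.\<close>

definition riemann_sphere :: "complex option topology" where
  "riemann_sphere = Alexandroff_compactification euclidean"

text \<open>Since functions are total, a meromorphic function carries an arbitrary value at its poles;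
  this is the map into the sphere that it represents.  It is meant for functions that are
  continuous off their poles (nicely meromorphic).\<close>

definition to_sphere :: "(complex \<Rightarrow> complex) \<Rightarrow> complex \<Rightarrow> complex option" where
  "to_sphere f w = (if is_pole f w then None else Some (f w))"

definition univalent_on :: "(complex \<Rightarrow> complex) \<Rightarrow> complex set \<Rightarrow> bool" where
  "univalent_on f S \<longleftrightarrow> f nicely_meromorphic_on S \<and> inj_on (to_sphere f) S"

definition simply_connectedin :: "'a topology \<Rightarrow> 'a set \<Rightarrow> bool" where
  "simply_connectedin X S \<longleftrightarrow> path_connectedin X S \<and>
     (\<forall>f. continuous_map (top_of_set (sphere (0::complex) 1)) (subtopology X S) f \<longrightarrow>
        (\<exists>a. homotopic_with (\<lambda>_. True) (top_of_set (sphere 0 1)) (subtopology X S) f (\<lambda>_. a)))"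

definition exterior_domain :: "complex option set \<Rightarrow> bool" where
  "exterior_domain \<Omega> \<longleftrightarrow>
     openin riemann_sphere \<Omega> \<and> simply_connectedin riemann_sphere \<Omega> \<and> None \<in> \<Omega>"

text \<open>As \<^term>\<open>None \<in> \<Omega>\<close> for an exterior domain, its complement consists of finite points.\<close>

definition droplet :: "complex option set \<Rightarrow> complex set" where
  "droplet \<Omega> = {z. Some z \<notin> \<Omega>}"

text \<open>An arc length parametrization, of period \<open>L\<close>, of the boundary of \<open>K\<close> as a simple closed
  curve, traversed counterclockwise (winding number \<open>1\<close> around interior points).  Thus
  \<^term>\<open>vector_derivative \<gamma> (at s)\<close> is the derivative with respect to arc length.\<close>

definition arclength_boundary :: "complex set \<Rightarrow> real \<Rightarrow> (real \<Rightarrow> complex) \<Rightarrow> bool" where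
  "arclength_boundary K L \<gamma> \<longleftrightarrow>
     L > 0 \<and>
     \<gamma> C1_differentiable_on UNIV \<and>
     (\<forall>s. norm (vector_derivative \<gamma> (at s)) = 1) \<and>
     (\<forall>s. \<gamma> (s + L) = \<gamma> s) \<and>
     inj_on \<gamma> {0..<L} \<and>
     \<gamma> ` {0..<L} = frontier K \<and>
     (\<forall>z\<in>interior K. winding_number (\<lambda>t. \<gamma> (L * t)) z = 1)"

definition phi :: "real \<Rightarrow> complex \<Rightarrow> complex" where
  "phi c w = - (1 / w) + 4 * of_real c / (1 - of_real c * w) - 4 * of_real c / (1 + of_real c * w)"

definition Omega :: "real \<Rightarrow> complex option set" where
  "Omega c = to_sphere (phi c) ` ball 0 1"

definition G_hat :: "real \<Rightarrow> complex \<Rightarrow> complex" where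
  "G_hat c w = of_real (9 * c^4 - 1) *
     (w * (3 + of_real (c^2) * w^2) / (1 + 3 * of_real (c^2) * w^2))"

text \<open>The inverse is taken on the closed disc, so that \<open>G_c\<close> is defined on the boundary as well.\<close>

definition G :: "real \<Rightarrow> complex option \<Rightarrow> complex" where
  "G c z = G_hat c (the_inv_into (cball 0 1) (to_sphere (phi c)) z)"

end

theory Submission
  imports Defs
begin

text \<open>With \<open>u = c\<^sup>2 w\<^sup>2\<close> one has \<open>phi c w = (9u - 1) / (w (1 - u))\<close>, and its derivative is the square of
  \<open>(1 + 3u) / (w (1 - u))\<close>. The reciprocal of \<open>phi c\<close> is holomorphic and injective on the disc of
  radius \<open>1/(3c) > 1\<close>, because \<open>phi c w - phi c v\<close> factors into \<open>w - v\<close> and two Moebius relations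
  between \<open>cw\<close> and \<open>cv\<close> that have no solution in the disc of radius \<open>1/3\<close>. On the unit circle,
  where \<open>cnj w = 1/w\<close>, the unit tangent \<open>- \<i> w phi' / \<bar>phi'\<bar>\<close> is thus a rational function of \<open>w\<close>,
  and the equation for \<open>G\<close> becomes a polynomial identity; a winding number computation shows that a
  counterclockwise boundary parametrization has this tangent and not its negative. The tangent angle
  at \<open>w = exp (- \<i> \<theta>)\<close> is, up to a constant, \<open>\<theta> + 2 arg ((1 + 3u) / (1 - u))\<close>; it is increasing for
  \<open>c \<le> c1\<close>, so every tangent line is a supporting line and the droplet is convex.\<close>

section \<open>The exterior map and the topology of the droplet\<close>

lemma topspace_riemann_sphere [simp]: "topspace riemann_sphere = UNIV"
  by (simp add: riemann_sphere_def UNIV_option_conv)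

text \<open>This is the chart of the sphere at infinity. Composed with the holomorphic reciprocal
  \<open>psi c\<close>, it gives continuity of \<open>to_sphere (phi c)\<close> across the pole with
  no separate argument there.\<close>

lemma continuous_map_inversion:
  "continuous_map euclidean riemann_sphere (\<lambda>x. if x = 0 then None else Some (inverse x))"
    (is "continuous_map _ _ ?J")
  unfolding continuous_map_def
proof (intro conjI allI impI)
  show "?J \<in> topspace euclidean \<rightarrow> topspace riemann_sphere"
    by simp
  fix V :: "complex option set"
  assume "openin riemann_sphere V"
  then consider (fin) U where "open U" "V = Some ` U"
    | (inf) C where "compact C" "V = insert None (Some ` (- C))"
    by (auto simp: riemann_sphere_def openin_Alexandroff_compactification Compl_eq_Diff_UNIV)
  then have "open {x. ?J x \<in> V}"
  proof cases
    case fin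
    have "{x. ?J x \<in> V} = (- {0}) \<inter> inverse -` U"
      using fin by auto
    moreover have "open ((- {0}) \<inter> inverse -` U)"
      using fin(1) by (intro continuous_open_preimage continuous_intros) auto
    ultimately show ?thesis by simp
  next
    case inf
    obtain B where B: "B > 0" "\<And>z. z \<in> C \<Longrightarrow> norm z \<le> B"
      using compact_imp_bounded[OF inf(1)] bounded_pos by blast
    \<comment> \<open>As \<open>inverse\<close> is continuous only off \<open>0\<close>, closedness
      of the preimage of \<open>C\<close> is shown inside a closed set that avoids \<open>0\<close>.
      Boundedness of \<open>C\<close> keeps its nonzero preimages at distance at least
      \<open>1 / B\<close> from \<open>0\<close>.\<close>
    define T :: "complex set" where "T = {x. 1 / B \<le> norm x}"
    have "0 \<notin> T" using B(1) by (auto simp: T_def)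
    have "closed T" unfolding T_def by (intro closed_Collect_le continuous_intros)
    then have "closed (T \<inter> inverse -` C)"
      using \<open>0 \<notin> T\<close> compact_imp_closed[OF inf(1)]
      by (intro continuous_closed_preimage continuous_intros) auto
    moreover have "{x. ?J x \<in> V} = - (T \<inter> inverse -` C)"
    proof -
      have "x \<in> T" if "inverse x \<in> C" "x \<noteq> 0" for x
        using B(2)[OF that(1)] that(2) B(1) unfolding norm_inverse by (simp add: T_def field_simps)
      then show ?thesis
        using inf(2) \<open>0 \<notin> T\<close> by auto
    qed
    ultimately show ?thesis by (simp only: open_Compl)
  qed
  then show "openin euclidean {x \<in> topspace euclidean. ?J x \<in> V}"
    by simp
qed

lemma Hausdorff_riemann_sphere: "Hausdorff_space riemann_sphere"
  by (simp add: riemann_sphere_def Hausdorff_space_Alexandroff_compactification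
      locally_compact_space_euclidean)

text \<open>The reciprocal of \<open>phi c\<close>, written so that it is holomorphic at the pole
  \<open>0\<close> of \<open>phi c\<close>. Its own poles are \<open>1 / (3 * c)\<close> and
  \<open>- 1 / (3 * c)\<close>, which explains the radius of the disc used below.\<close>

definition psi :: "real \<Rightarrow> complex \<Rightarrow> complex" where
  "psi c w = w * (1 - of_real (c^2) * w^2) / (9 * of_real (c^2) * w^2 - 1)"

text \<open>The Moebius map \<open>a \<mapsto> (a - 1) / (1 + 3 a)\<close> throws the disc of radius \<open>1/3\<close> off itself.\<close>

lemma moebius_nonzero:
  fixes a b :: complex
  assumes "norm a < 1/3" "norm b < 1/3"
  shows "1 + 3 * a * b - a + b \<noteq> 0"
proof
  assume "1 + 3 * a * b - a + b = 0"
  then have eq: "b * (1 + 3 * a) = a - 1" by (simp add: algebra_simps)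
  have "Re a < 1/3" using assms(1) complex_Re_le_cmod[of a] by linarith
  \<comment> \<open>After expansion the terms in \<open>(norm a)^2\<close> cancel, and what remains
    is exactly \<open>Re a < 1/3\<close>.\<close>
  then have "(norm (1 + 3 * a))^2 < (3 * norm (a - 1))^2"
    by (simp add: power_mult_distrib cmod_power2) (simp add: power2_eq_square algebra_simps)
  then have lt: "norm (1 + 3 * a) < 3 * norm (a - 1)"
    by (rule power2_less_imp_less) simp
  have "norm (a - 1) = norm b * norm (1 + 3 * a)"
    by (simp flip: eq add: norm_mult)
  also have "\<dots> \<le> (1/3) * norm (1 + 3 * a)"
    using assms(2) by (intro mult_right_mono) auto
  finally show False using lt by simp
qed

section \<open>Injectivity and derivative of the exterior map\<close>

context
  fixes c :: real
  assumes c: "0 < c" "c < 1/3"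
begin

text \<open>The bound \<open>c < 1/3\<close> enters here: the closed unit disc lies inside an open
  disc on which \<open>psi c\<close> is holomorphic and injective, so the unit circle needs no
  limiting argument.\<close>

lemma one_less_radius: "1 < 1 / (3 * c)"
  using c by (simp add: field_simps)

lemma cball_radius:
  fixes w :: complex
  shows "w \<in> cball 0 1 \<Longrightarrow> w \<in> ball 0 (1 / (3 * c))"
  using one_less_radius by auto

lemma norm_cw:
  fixes w :: complex
  shows "w \<in> ball 0 (1 / (3 * c)) \<Longrightarrow> norm (of_real c * w) < 1/3"
  using c by (simp add: norm_mult field_simps)

text \<open>On this disc \<open>(c w)^2\<close> has modulus below \<open>1/9\<close>, whereas the
  three quadratic factors vanish where it equals \<open>1\<close>, \<open>1/9\<close> and
  \<open>-1/3\<close>.\<close>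

lemma denominators_nonzero:
  fixes w :: complex
  assumes "w \<in> ball 0 (1 / (3 * c))"
  shows "1 - of_real (c^2) * w^2 \<noteq> 0" "9 * of_real (c^2) * w^2 - 1 \<noteq> 0"
    "1 + 3 * of_real (c^2) * w^2 \<noteq> 0"
    "1 - of_real c * w \<noteq> 0" "1 + of_real c * w \<noteq> 0"
proof -
  have *: "norm ((of_real c * w)^2) < (1/3)^2"
    unfolding norm_power using norm_cw[OF assms] by (intro power_strict_mono) auto
  have ne: "norm x < r \<Longrightarrow> x \<noteq> y" if "norm y \<ge> r" for x y :: complex and r
    using that by auto
  have "(of_real c * w)^2 \<noteq> 1" "(of_real c * w)^2 \<noteq> 1/9" and third: "(of_real c * w)^2 \<noteq> -1/3"
    by (rule ne[OF _ *], simp add: power2_eq_square norm_divide)+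
  then show "1 - of_real (c^2) * w^2 \<noteq> 0" "9 * of_real (c^2) * w^2 - 1 \<noteq> 0"
    by (auto simp: power_mult_distrib field_simps)
  show "1 + 3 * of_real (c^2) * w^2 \<noteq> 0"
  proof
    assume "1 + 3 * of_real (c^2) * w^2 = 0"
    then have "3 * (of_real c * w)^2 = -1"
      by (simp add: add_eq_0_iff power_mult_distrib mult.assoc)
    then show False using third by (metis nonzero_mult_div_cancel_left zero_neq_numeral)
  qed
  have "of_real c * w \<noteq> 1" "of_real c * w \<noteq> -1"
    by (rule ne[OF _ norm_cw[OF assms]], simp)+
  then show "1 - of_real c * w \<noteq> 0" "1 + of_real c * w \<noteq> 0"
    by (auto simp: add_eq_0_iff)
qed

lemma phi_closed_form:
  assumes "w \<in> ball 0 (1 / (3 * c))" "w \<noteq> 0"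
  shows "phi c w = (9 * of_real (c^2) * w^2 - 1) / (w * (1 - of_real (c^2) * w^2))"
proof -
  have "(1 - of_real (c^2) * w^2) = (1 - of_real c * w) * (1 + of_real c * w)"
    by (simp add: algebra_simps power2_eq_square)
  then show ?thesis
    using denominators_nonzero(4,5)[OF assms(1)] assms(2) unfolding phi_def
    by (simp add: divide_simps) (simp add: algebra_simps power2_eq_square)
qed

text \<open>At \<open>w = 0\<close> both sides are \<open>0\<close>, as \<open>1/0 = 0\<close>.\<close>

lemma phi_eq_inverse_psi:
  assumes "w \<in> ball 0 (1 / (3 * c))"
  shows "phi c w = inverse (psi c w)"
  using phi_closed_form[OF assms] by (cases "w = 0") (simp_all add: psi_def phi_def)

lemma psi_eq_0_iff: "w \<in> ball 0 (1 / (3 * c)) \<Longrightarrow> psi c w = 0 \<longleftrightarrow> w = 0"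
  using denominators_nonzero by (auto simp: psi_def)

lemma psi_holomorphic: "psi c holomorphic_on ball 0 (1 / (3 * c))"
  unfolding psi_def using denominators_nonzero(2) by (intro holomorphic_intros) auto

lemma psi_inj: "inj_on (psi c) (ball 0 (1 / (3 * c)))"
proof (rule inj_onI)
  fix w v assume wv: "w \<in> ball 0 (1 / (3 * c))" "v \<in> ball 0 (1 / (3 * c))" "psi c w = psi c v"
  define a b where "a = of_real c * w" and "b = of_real c * v"
  have "w * (1 - of_real (c^2) * w^2) * (9 * of_real (c^2) * v^2 - 1) =
      v * (1 - of_real (c^2) * v^2) * (9 * of_real (c^2) * w^2 - 1)"
    using wv(3) denominators_nonzero(2)[OF wv(1)] denominators_nonzero(2)[OF wv(2)]
    by (simp add: psi_def frac_eq_eq)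
  \<comment> \<open>The last two factors arise from each other by exchanging \<open>a\<close> and
    \<open>b\<close>, so \<open>moebius_nonzero\<close> excludes the zeros of both and leaves
    \<open>w = v\<close>.\<close>
  then have "(w - v) * ((1 + 3 * a * b - a + b) * (1 + 3 * b * a - b + a)) = 0"
    unfolding a_def b_def by (simp add: algebra_simps power2_eq_square)
  moreover have "norm a < 1/3" "norm b < 1/3"
    using wv norm_cw by (auto simp: a_def b_def)
  ultimately show "w = v"
    using moebius_nonzero by auto
qed

lemma phi_has_field_derivative:
  assumes "w \<in> ball 0 (1 / (3 * c))" "w \<noteq> 0"
  shows "(phi c has_field_derivative
    ((1 + 3 * of_real (c^2) * w^2) / (w * (1 - of_real (c^2) * w^2)))^2) (at w)"
proof -
  have eq: "(1 - of_real (c^2) * w^2) = (1 - of_real c * w) * (1 + of_real c * w)"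
    by (simp add: algebra_simps power2_eq_square)
  have "(phi c has_field_derivative (1 / w^2 + 4 * of_real c^2 / (1 - of_real c * w)^2
      + 4 * of_real c^2 / (1 + of_real c * w)^2)) (at w)"
    unfolding phi_def[abs_def]
    by (rule derivative_eq_intros refl | use assms denominators_nonzero(4,5)[OF assms(1)] in
      \<open>simp; fail\<close>)+
     (use assms denominators_nonzero(4,5)[OF assms(1)] in \<open>simp add: power2_eq_square mult.assoc\<close>)
  moreover have "1 / w^2 + 4 * of_real c^2 / (1 - of_real c * w)^2
      + 4 * of_real c^2 / (1 + of_real c * w)^2 =
    ((1 + 3 * of_real (c^2) * w^2) / (w * (1 - of_real (c^2) * w^2)))^2"
    unfolding eq using assms denominators_nonzero(4,5)[OF assms(1)]
    by (simp add: power_mult_distrib power_divide divide_simps) (simp add: algebra_simps eval_nat_numeral)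
  ultimately show ?thesis by simp
qed

lemma phi_holomorphic: "phi c holomorphic_on ball 0 (1 / (3 * c)) - {0}"
  by (subst holomorphic_on_open) (auto simp: open_Diff intro!: exI phi_has_field_derivative)

text \<open>With \<open>inverse 0 = 0\<close>, \<open>inverse\<close> is injective everywhere, so
  injectivity of \<open>psi c\<close> carries over even to the conventional value of
  \<open>phi c\<close> at its pole.\<close>

lemma phi_inj: "inj_on (phi c) (ball 0 (1 / (3 * c)))"
  using psi_inj by (auto simp: inj_on_def phi_eq_inverse_psi)

lemma is_pole_phi_0: "is_pole (phi c) 0"
proof -
  have R: "0 \<in> ball (0::complex) (1 / (3 * c))" using c by auto
  have "isCont (psi c) 0"
    using psi_holomorphic R by (metis holomorphic_on_imp_continuous_on open_ball continuous_on_eq_continuous_at)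
  then have "(psi c \<longlongrightarrow> 0) (at 0)"
    by (simp add: isCont_def psi_def)
  moreover have ev: "\<forall>\<^sub>F w in at 0. w \<in> ball 0 (1 / (3 * c)) - {0}"
    using R by (intro eventually_at_in_open) auto
  then have "\<forall>\<^sub>F w in at 0. psi c w \<noteq> 0"
    by eventually_elim (use psi_eq_0_iff in auto)
  ultimately have "filterlim (\<lambda>w. inverse (psi c w)) at_infinity (at 0)"
    by (intro filterlim_compose[OF filterlim_inverse_at_infinity]) (auto simp: filterlim_at)
  moreover have "\<forall>\<^sub>F w in at 0. phi c w = inverse (psi c w)"
    using ev by eventually_elim (use phi_eq_inverse_psi in auto)
  ultimately show ?thesis
    unfolding is_pole_def by (subst filterlim_cong[OF refl refl]) auto
qed

section \<open>The map into the sphere and the exterior domain\<close>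

lemma to_sphere_phi:
  assumes "w \<in> ball 0 (1 / (3 * c))"
  shows "to_sphere (phi c) w = (if w = 0 then None else Some (phi c w))"
proof (cases "w = 0")
  case False
  then have "\<not> is_pole (phi c) w"
    using assms phi_holomorphic by (intro not_is_pole_holomorphic[of "ball 0 (1 / (3 * c)) - {0}"]) auto
  then show ?thesis using False by (simp add: to_sphere_def)
qed (simp add: to_sphere_def is_pole_phi_0)

lemma to_sphere_phi_inj: "inj_on (to_sphere (phi c)) (ball 0 (1 / (3 * c)))"
  using phi_inj by (auto simp: inj_on_def to_sphere_phi split: if_splits)

lemma to_sphere_phi_inj_cball: "inj_on (to_sphere (phi c)) (cball 0 1)"
  using to_sphere_phi_inj cball_radius by (blast intro: inj_on_subset)

lemma continuous_map_to_sphere_phi: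
  "continuous_map (top_of_set (cball 0 1)) riemann_sphere (to_sphere (phi c))"
proof -
  have "continuous_on (cball 0 1) (psi c)"
    using psi_holomorphic cball_radius
    by (meson holomorphic_on_imp_continuous_on continuous_on_subset subsetI)
  then have "continuous_map (top_of_set (cball 0 1)) euclidean (psi c)"
    by simp
  then have "continuous_map (top_of_set (cball 0 1)) riemann_sphere
      ((\<lambda>x. if x = 0 then None else Some (inverse x)) \<circ> psi c)"
    using continuous_map_inversion by (rule continuous_map_compose)
  then show ?thesis
    by (rule continuous_map_eq)
      (use cball_radius in \<open>auto simp: to_sphere_phi psi_eq_0_iff phi_eq_inverse_psi\<close>)
qed

lemma univalent_phi: "univalent_on (phi c) (ball 0 1)"
proof -
  have "phi c meromorphic_on ball 0 1"
    unfolding phi_def by (intro meromorphic_intros)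
  \<comment> \<open>Nice meromorphy asks for the value \<open>0\<close> at a pole. It holds at
    \<open>w = 0\<close> since \<open>1/0 = 0\<close> and the two remaining fractions cancel
    there.\<close>
  moreover have "is_pole (phi c) w \<and> phi c w = 0 \<or> phi c \<midarrow>w\<rightarrow> phi c w" if "w \<in> ball 0 1" for w
  proof (cases "w = 0")
    case True
    then show ?thesis using is_pole_phi_0 by (simp add: phi_def)
  next
    case False
    then show ?thesis
      using that cball_radius[of w] phi_has_field_derivative[of w]
      by (auto dest: DERIV_isCont simp: isCont_def)
  qed
  moreover have "inj_on (to_sphere (phi c)) (ball 0 1)"
    using to_sphere_phi_inj_cball by (rule inj_on_subset) auto
  ultimately show ?thesis
    by (auto simp: univalent_on_def nicely_meromorphic_on_def)
qed

lemma G_to_sphere: "w \<in> cball 0 1 \<Longrightarrow> G c (to_sphere (phi c) w) = G_hat c w"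
  by (simp add: G_def the_inv_into_f_f[OF to_sphere_phi_inj_cball])

text \<open>A continuous injection of a compact space into a Hausdorff space is an embedding. This
  applies to the closed disc, and the homeomorphism is then restricted to the open one.\<close>

lemma homeomorphic_Omega:
  "homeomorphic_map (top_of_set (ball 0 1)) (subtopology riemann_sphere (Omega c)) (to_sphere (phi c))"
proof -
  have "embedding_map (top_of_set (cball 0 1)) riemann_sphere (to_sphere (phi c))"
    using continuous_map_to_sphere_phi Hausdorff_riemann_sphere to_sphere_phi_inj_cball
    by (intro continuous_imp_embedding_map) (auto simp: compact_space_subtopology)
  then have "homeomorphic_map (top_of_set (cball 0 1))
      (subtopology riemann_sphere (to_sphere (phi c) ` cball 0 1)) (to_sphere (phi c))"
    by (simp add: embedding_map_def)
  then have "homeomorphic_map (subtopology (top_of_set (cball 0 1)) (ball 0 1))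
      (subtopology (subtopology riemann_sphere (to_sphere (phi c) ` cball 0 1)) (Omega c)) (to_sphere (phi c))"
    by (rule homeomorphic_map_subtopologies)
      (auto simp: Omega_def dest: inj_onD[OF to_sphere_phi_inj_cball])
  moreover have "cball (0::complex) 1 \<inter> ball 0 1 = ball 0 1"
    "to_sphere (phi c) ` cball 0 1 \<inter> Omega c = Omega c"
    by (auto simp: Omega_def)
  ultimately show ?thesis
    by (simp add: subtopology_subtopology)
qed

lemma simply_connected_Omega: "simply_connectedin riemann_sphere (Omega c)"
proof -
  have "contractible (ball (0::complex) 1)"
    by (simp add: convex_imp_contractible)
  then have con: "contractible_space (subtopology riemann_sphere (Omega c))"
    using homeomorphic_map_imp_homeomorphic_space[OF homeomorphic_Omega]
    by (metis contractible_space_top_of_set homeomorphic_space_contractibility)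
  moreover have "\<exists>a. homotopic_with (\<lambda>_. True) (top_of_set (sphere 0 1))
      (subtopology riemann_sphere (Omega c)) f (\<lambda>_. a)"
    if "continuous_map (top_of_set (sphere (0::complex) 1)) (subtopology riemann_sphere (Omega c)) f" for f
    using nullhomotopic_into_contractible_space[OF that con] by blast
  ultimately show ?thesis
    by (simp add: simply_connectedin_def path_connectedin_def contractible_imp_path_connected_space)
qed

section \<open>Frontier, interior and compactness of the droplet\<close>

lemma droplet_eq: "droplet (Omega c) = - phi c ` (ball 0 1 - {0})"
proof -
  have "Some z \<in> Omega c \<longleftrightarrow> z \<in> phi c ` (ball 0 1 - {0})" for z
  proof -
    have "Some z \<in> Omega c \<longleftrightarrow> (\<exists>w\<in>ball 0 1. Some z = to_sphere (phi c) w)"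
      by (auto simp: Omega_def)
    also have "\<dots> \<longleftrightarrow> (\<exists>w\<in>ball 0 1. w \<noteq> 0 \<and> z = phi c w)"
      using cball_radius by (intro bex_cong) (auto simp: to_sphere_phi)
    finally show ?thesis by auto
  qed
  then show ?thesis by (auto simp: droplet_def)
qed

lemma open_phi_image: "open (phi c ` (ball 0 1 - {0}))"
proof (rule open_mapping_thm3)
  have sub: "ball 0 1 \<subseteq> ball 0 (1 / (3 * c))" using one_less_radius by auto
  show "phi c holomorphic_on ball 0 1 - {0}"
    using phi_holomorphic by (rule holomorphic_on_subset) (use sub in auto)
  show "inj_on (phi c) (ball 0 1 - {0})"
    using phi_inj by (rule inj_on_subset) (use sub in auto)
qed (auto simp: open_Diff)

text \<open>The set is unbounded in the plane, so compactness is used on the sphere: the image of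
  the closed disc is closed there, and its preimage under \<open>Some\<close> drops the point at
  infinity.\<close>

lemma closed_phi_image: "closed (phi c ` (cball 0 1 - {0}))"
proof -
  have "compactin riemann_sphere (to_sphere (phi c) ` cball 0 1)"
    by (rule image_compactin[OF _ continuous_map_to_sphere_phi]) (simp add: compactin_subtopology)
  then have "closedin riemann_sphere (to_sphere (phi c) ` cball 0 1)"
    using Hausdorff_riemann_sphere by (rule compactin_imp_closedin[rotated])
  then have "closedin euclidean {z \<in> topspace euclidean. Some z \<in> to_sphere (phi c) ` cball 0 1}"
    using continuous_map_Some unfolding riemann_sphere_def by (rule closedin_continuous_map_preimage[rotated])
  moreover have "{z. Some z \<in> to_sphere (phi c) ` cball 0 1} = phi c ` (cball 0 1 - {0})"
    using cball_radius by (force simp: to_sphere_phi image_iff split: if_splits)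
  ultimately show ?thesis by simp
qed

text \<open>The closure of the open image adds only the image of the circle, by
  \<open>closed_phi_image\<close>, and all of it, by continuity. Injectivity up to the boundary
  keeps the two images disjoint.\<close>

lemma frontier_droplet: "frontier (droplet (Omega c)) = phi c ` sphere 0 1"
proof -
  let ?U = "phi c ` (ball 0 1 - {0})"
  have sph: "phi c w \<in> closure ?U" if "w \<in> sphere 0 1" for w
  proof (rule Lim_in_closed_set)
    have w: "w \<noteq> 0" "w \<in> ball 0 (1 / (3 * c))" using that cball_radius[of w] by auto
    then have "isCont (phi c) w"
      using phi_has_field_derivative DERIV_isCont by blast
    then show "(phi c \<longlongrightarrow> phi c w) (at w within ball 0 1)"
      using continuous_at_imp_continuous_at_within continuous_within by blast
    have "\<forall>\<^sub>F x in at w within ball 0 1. x \<noteq> 0"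
      using tendsto_imp_eventually_ne[OF tendsto_ident_at w(1)] .
    moreover have "\<forall>\<^sub>F x in at w within ball 0 1. x \<in> ball 0 1"
      by (simp add: eventually_at_filter)
    ultimately show "\<forall>\<^sub>F x in at w within ball 0 1. phi c x \<in> closure ?U"
      by eventually_elim (auto intro!: closure_subset[THEN subsetD])
    show "at w within ball 0 1 \<noteq> bot"
      using that by (simp add: trivial_limit_within islimpt_ball)
  qed simp
  have cball: "phi c ` (cball 0 1 - {0}) = ?U \<union> phi c ` sphere 0 1"
    by force
  have "closure ?U = ?U \<union> phi c ` sphere 0 1"
  proof
    show "closure ?U \<subseteq> ?U \<union> phi c ` sphere 0 1"
      using closed_phi_image unfolding cball by (intro closure_minimal) auto
    show "?U \<union> phi c ` sphere 0 1 \<subseteq> closure ?U"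
      using sph closure_subset[of ?U] by auto
  qed
  moreover have "?U \<inter> phi c ` sphere 0 1 = {}"
  proof -
    have "phi c w \<noteq> phi c v" if "w \<in> ball 0 1" "v \<in> sphere 0 1" for w v
      using that cball_radius[of w] cball_radius[of v] inj_onD[OF phi_inj, of w v] by auto
    then show ?thesis by blast
  qed
  ultimately show ?thesis
    unfolding droplet_eq frontier_complement unfolding frontier_def interior_open[OF open_phi_image]
    by auto
qed

text \<open>Boundedness comes from the open mapping theorem: \<open>psi c\<close> covers a ball of
  radius \<open>e\<close> around \<open>0\<close>, hence \<open>phi c\<close> takes every value of
  modulus above \<open>1 / e\<close>.\<close>

lemma compact_droplet: "compact (droplet (Omega c))"
proof -
  have "open (psi c ` ball 0 1)"
    using psi_holomorphic psi_inj cball_radius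
    by (intro open_mapping_thm3) (auto intro: holomorphic_on_subset inj_on_subset)
  moreover have "0 \<in> psi c ` ball 0 1"
    by (rule image_eqI[of _ _ 0]) (simp_all add: psi_def)
  ultimately obtain e where e: "e > 0" "ball 0 e \<subseteq> psi c ` ball 0 1"
    by (meson open_contains_ball)
  have "norm z \<le> 1 / e" if "z \<in> droplet (Omega c)" for z
  proof (rule ccontr)
    assume "\<not> norm z \<le> 1 / e"
    then have z: "1 / e < norm z" by simp
    then have "z \<noteq> 0" using e(1) by (auto simp: field_simps)
    have "inverse z \<in> ball 0 e"
      using z e(1) \<open>z \<noteq> 0\<close> by (simp only: mem_ball_0 norm_inverse) (simp add: field_simps)
    then obtain w where w: "w \<in> ball 0 1" "inverse z = psi c w"
      using e(2) by blast
    have "z = phi c w"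
      using w cball_radius[of w] by (metis phi_eq_inverse_psi inverse_inverse_eq ball_subset_cball subsetD)
    moreover have "w \<noteq> 0" using w(2) \<open>z \<noteq> 0\<close> by (auto simp: psi_def)
    ultimately show False using that w(1) by (auto simp: droplet_eq)
  qed
  then have "bounded (droplet (Omega c))" by (auto simp: bounded_iff)
  moreover have "closed (droplet (Omega c))"
    using open_phi_image by (auto simp: droplet_eq)
  ultimately show ?thesis by (simp add: compact_eq_bounded_closed)
qed

lemma exterior_Omega: "exterior_domain (Omega c)"
proof -
  have "None \<in> Omega c"
    unfolding Omega_def by (rule image_eqI[of _ _ 0]) (simp_all add: to_sphere_def is_pole_phi_0)
  have "x \<in> Omega c \<longleftrightarrow> x \<in> insert None (Some ` (topspace euclidean - droplet (Omega c)))" for x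
    using \<open>None \<in> Omega c\<close> by (cases x) (auto simp: droplet_def)
  then have "Omega c = insert None (Some ` (topspace euclidean - droplet (Omega c)))"
    by blast
  then have "openin riemann_sphere (Omega c)"
    unfolding riemann_sphere_def openin_Alexandroff_compactification
    using compact_droplet compact_imp_closed[OF compact_droplet]
    by (intro disjI2 exI[of _ "droplet (Omega c)"]) simp
  then show ?thesis
    using simply_connected_Omega \<open>None \<in> Omega c\<close> by (simp add: exterior_domain_def)
qed

lemma interior_droplet: "interior (droplet (Omega c)) = - phi c ` (cball 0 1 - {0})"
proof -
  have "phi c ` (cball 0 1 - {0}) = phi c ` (ball 0 1 - {0}) \<union> phi c ` sphere 0 1"
    by force
  moreover have "interior K = K - frontier K" if "closed K" for K :: "complex set"
    using that by (auto simp: frontier_def interior_subset[THEN subsetD])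
  ultimately show ?thesis
    using compact_imp_closed[OF compact_droplet] frontier_droplet by (auto simp: droplet_eq)
qed

text \<open>This supplies the reference point for the winding number that fixes the orientation and
  for the convexity criterion.\<close>

lemma zero_interior_droplet: "0 \<in> interior (droplet (Omega c))"
proof -
  have "phi c w \<noteq> 0" if "w \<in> cball 0 1 - {0}" for w
    using that cball_radius[of w] by (simp add: phi_eq_inverse_psi psi_eq_0_iff)
  then show ?thesis by (force simp: interior_droplet)
qed

end

section \<open>The tangent of the boundary curve\<close>

text \<open>The derivative of \<open>phi c\<close> off \<open>0\<close>, kept as a perfect square so
  that its norm becomes \<open>q * cnj q\<close> and the unit tangent needs no square root.\<close>

definition dphi :: "real \<Rightarrow> complex \<Rightarrow> complex" where
  "dphi c w = ((1 + 3 * of_real (c^2) * w^2) / (w * (1 - of_real (c^2) * w^2)))^2"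

context
  fixes c :: real
  assumes c: "0 < c" "c < 1/3"
begin

lemma dphi_nonzero: "w \<in> ball 0 (1 / (3 * c)) \<Longrightarrow> w \<noteq> 0 \<Longrightarrow> dphi c w \<noteq> 0"
  using denominators_nonzero[OF c] by (simp add: dphi_def)

lemma continuous_dphi: "continuous_on (sphere 0 1) (dphi c)"
  unfolding dphi_def using denominators_nonzero(1)[OF c] cball_radius[OF c]
  by (intro continuous_intros) force

lemma sphere_radius:
  fixes w :: complex
  shows "w \<in> sphere 0 1 \<Longrightarrow> w \<in> ball 0 (1 / (3 * c)) \<and> w \<noteq> 0"
  using cball_radius[OF c, of w] by auto

text \<open>Since \<open>phi c - z\<close> is \<open>1/w\<close> times a zero-free function on the closed disc, the factor
  with a continuous logarithm there does not contribute to the winding number.\<close>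

lemma winding_number_phi_path:
  assumes p: "path p" "path_image p \<subseteq> sphere 0 1" "pathfinish p = pathstart p"
    and z: "z \<in> interior (droplet (Omega c))"
  shows "winding_number (\<lambda>t. phi c (p t)) z = - winding_number p 0"
proof -
  \<comment> \<open>This is \<open>w * (phi c w - z)\<close> with the singularity at
    \<open>0\<close> removed; there \<open>h\<close> has the value \<open>-1\<close>.\<close>
  define h where "h w = (9 * of_real (c^2) * w^2 - 1) / (1 - of_real (c^2) * w^2) - z * w" for w
  have h: "h w = w * (phi c w - z)" if "w \<in> cball 0 1" "w \<noteq> 0" for w
    using phi_closed_form[OF c cball_radius[OF c that(1)] that(2)] that(2)
      denominators_nonzero(1)[OF c cball_radius[OF c that(1)]]
    by (simp add: h_def field_simps)
  have "h w \<noteq> 0" if "w \<in> cball 0 1" for w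
  proof (cases "w = 0")
    case False
    then have "phi c w \<noteq> z" using z that by (auto simp: interior_droplet[OF c])
    then show ?thesis using h[OF that False] False by simp
  qed (simp add: h_def)
  moreover have "continuous_on (cball 0 1) h"
    unfolding h_def using denominators_nonzero(1)[OF c cball_radius[OF c]]
    by (intro continuous_intros) auto
  ultimately obtain l where l: "continuous_on (cball 0 1) l" "\<And>w. w \<in> cball 0 1 \<Longrightarrow> h w = exp (l w)"
    using continuous_logarithm_on_cball[of 0 1 h] by metis
  have "0 \<notin> path_image p" using p(2) by auto
  then obtain q where q: "path q"
      "pathfinish q - pathstart q = 2 * of_real pi * \<i> * winding_number p 0"
      "\<And>t. t \<in> {0..1} \<Longrightarrow> p t = 0 + exp (q t)"
    using winding_number_as_continuous_log[OF p(1)] by metis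
  have pt: "p t \<in> sphere 0 1" if "t \<in> {0..1}" for t
    using p(2) that unfolding path_image_def by blast
  have "path (\<lambda>t. l (p t))"
    unfolding path_def using p(1) pt
    by (intro continuous_on_compose2[OF l(1)]) (auto simp: path_def)
  then have path: "path (\<lambda>t. l (p t) - q t)"
    using q(1) unfolding path_def by (intro continuous_intros)
  have eq: "phi c (p t) - z = (exp \<circ> (\<lambda>t. l (p t) - q t)) t" if "0 \<le> t" "t \<le> 1" for t
    using h[of "p t"] l(2)[of "p t"] pt[of t] q(3)[of t] that
    by (auto simp: exp_diff field_simps)
  have "winding_number (\<lambda>t. phi c (p t)) z = winding_number (\<lambda>t. phi c (p t) - z) 0"
    by (rule winding_number_offset)
  also have "\<dots> = winding_number (exp \<circ> (\<lambda>t. l (p t) - q t)) 0"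
    by (rule winding_number_cong) (rule eq)
  also have "\<dots> = - (pathfinish q - pathstart q) / (2 * of_real pi * \<i>)"
    unfolding winding_number_compose_exp[OF path] using p(3)
    by (simp add: pathstart_def pathfinish_def)
  finally show ?thesis using q(2) by simp
qed

text \<open>Pulled back by the inverse of \<open>phi c\<close>, \<gamma> becomes a C1 curve
  \<open>w\<close> on the unit circle, so \<open>w' = \<i> * \<kappa> * w\<close> with \<kappa>
  real. Unit speed determines the modulus of \<kappa>, and the orientation determines its
  sign.\<close>

lemma arclength_boundary_tangent:
  assumes "arclength_boundary (droplet (Omega c)) L \<gamma>"
  obtains w where "w \<in> sphere 0 1" "\<gamma> s = phi c w"
    "vector_derivative \<gamma> (at s) = - \<i> * w * dphi c w / of_real (norm (dphi c w))"
proof -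
  let ?S = "ball 0 (1 / (3 * c)) - {0::complex}"
  from assms have L: "L > 0" and C1: "\<gamma> C1_differentiable_on UNIV"
    and unit: "\<And>s. norm (vector_derivative \<gamma> (at s)) = 1"
    and per: "\<And>s. \<gamma> (s + L) = \<gamma> s" and im: "\<gamma> ` {0..<L} = phi c ` sphere 0 1"
    and wind: "\<And>z. z \<in> interior (droplet (Omega c)) \<Longrightarrow> winding_number (\<lambda>t. \<gamma> (L * t)) z = 1"
    by (auto simp: arclength_boundary_def frontier_droplet[OF c])
  define D where "D s = vector_derivative \<gamma> (at s)" for s
  have D: "(\<gamma> has_vector_derivative D s) (at s)" for s
    using C1 unfolding C1_differentiable_on_eq D_def by (simp add: vector_derivative_works[symmetric])
  have contD: "continuous_on UNIV D"
    using C1 unfolding C1_differentiable_on_eq D_def by blast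
  have mem: "\<gamma> s \<in> phi c ` sphere 0 1" for s
  proof -
    interpret periodic_fun_simple \<gamma> L by unfold_locales (rule per)
    define n where "n = \<lfloor>s / L\<rfloor>"
    have "of_int n \<le> s / L" "s / L < of_int n + 1" by (auto simp: n_def)
    then have "s - of_int n * L \<in> {0..<L}" using L by (auto simp: field_simps)
    then have "\<gamma> (s - of_int n * L) \<in> phi c ` sphere 0 1" using im by blast
    then show ?thesis by (simp add: minus_of_int)
  qed
  have "phi c holomorphic_on ?S" by (rule phi_holomorphic[OF c])
  moreover have inj: "inj_on (phi c) ?S" using phi_inj[OF c] by (rule inj_on_subset) auto
  moreover have op: "open ?S" by (simp add: open_Diff)
  ultimately obtain g where g: "\<And>z. z \<in> ?S \<Longrightarrow> g (phi c z) = z"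
    by (metis holomorphic_has_inverse)
  have g': "(g has_field_derivative inverse (dphi c z)) (at (phi c z))" if "z \<in> ?S" for z
  proof (rule has_field_derivative_inverse_strong[where f = "phi c", OF _ _ op that _ g])
    show "(phi c has_field_derivative dphi c z) (at z)"
      using phi_has_field_derivative[OF c] that by (auto simp: dphi_def)
    show "dphi c z \<noteq> 0" using dphi_nonzero that by auto
    show "continuous_on ?S (phi c)" using phi_holomorphic[OF c] by (rule holomorphic_on_imp_continuous_on)
  qed
  define w where "w s = g (\<gamma> s)" for s
  have w: "w s \<in> sphere 0 1" "\<gamma> s = phi c (w s)" for s
  proof -
    obtain v where "v \<in> sphere 0 1" "\<gamma> s = phi c v" using mem by blast
    then show "w s \<in> sphere 0 1" "\<gamma> s = phi c (w s)"
      using g[of v] sphere_radius[of v] by (auto simp: w_def)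
  qed
  have wS: "w s \<in> ?S" for s using sphere_radius w(1) by blast
  define w' where "w' s = D s * inverse (dphi c (w s))" for s
  have w': "(w has_vector_derivative w' s) (at s)" for s
  proof -
    have "(g has_field_derivative inverse (dphi c (w s))) (at (\<gamma> s))"
      using g'[OF wS[of s]] by (simp only: w(2)[symmetric])
    then have "(g \<circ> \<gamma> has_vector_derivative D s * inverse (dphi c (w s))) (at s)"
      by (rule field_vector_diff_chain_at[OF D])
    then show ?thesis by (simp only: w_def[abs_def] w'_def o_def)
  qed
  have contw: "continuous_on UNIV w"
    using w' by (meson continuous_at_imp_continuous_on has_vector_derivative_continuous)
  have "continuous_on UNIV (\<lambda>s. dphi c (w s))"
    using contw w(1) by (intro continuous_on_compose2[OF continuous_dphi]) auto
  then have contw': "continuous_on UNIV w'"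
    unfolding w'_def using contD dphi_nonzero wS by (intro continuous_intros) auto
  define \<kappa> where "\<kappa> s = Im (w' s * cnj (w s))" for s
  have cont\<kappa>: "continuous_on UNIV \<kappa>"
    unfolding \<kappa>_def using contw contw' by (intro continuous_intros)
  have ww: "w s * cnj (w s) = 1" for s
    using w(1)[of s] by (simp add: complex_norm_square[symmetric])
  have w'_eq: "w' s = \<i> * of_real (\<kappa> s) * w s" for s
  proof -
    have "((\<lambda>s. w s \<bullet> w s) has_vector_derivative (w s \<bullet> w' s + w' s \<bullet> w s)) (at s)"
      using bounded_bilinear.has_vector_derivative[OF bounded_bilinear_inner w' w'] by simp
    moreover have "(\<lambda>s. w s \<bullet> w s) = (\<lambda>s. 1)"
      using w(1) by (auto simp: dot_square_norm)
    ultimately have "((\<lambda>s. 1::real) has_vector_derivative (w s \<bullet> w' s + w' s \<bullet> w s)) (at s)"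
      by simp
    then have "w s \<bullet> w' s + w' s \<bullet> w s = 0"
      using has_vector_derivative_const vector_derivative_unique_at by blast
    then have "Re (w' s * cnj (w s)) = 0"
      by (simp add: inner_complex_def algebra_simps)
    then have "w' s * cnj (w s) = \<i> * of_real (\<kappa> s)"
      by (simp add: complex_eq_iff \<kappa>_def)
    then have "w' s * (w s * cnj (w s)) = \<i> * of_real (\<kappa> s) * w s"
      by (simp add: mult.assoc mult.commute)
    then show ?thesis by (simp add: ww)
  qed
  have abs\<kappa>: "\<bar>\<kappa> s\<bar> = 1 / norm (dphi c (w s))" for s
  proof -
    have "norm (w' s) = \<bar>\<kappa> s\<bar>" using w(1)[of s] by (simp add: w'_eq norm_mult)
    moreover have "norm (w' s) = 1 / norm (dphi c (w s))"
      using unit[of s] by (simp add: w'_def D_def norm_divide divide_inverse[symmetric])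
    ultimately show ?thesis by simp
  qed
  have \<kappa>0: "\<kappa> s \<noteq> 0" for s
    using abs\<kappa>[of s] dphi_nonzero[of "w s"] wS[of s] by auto
  \<comment> \<open>If \<kappa> were positive once, it would be positive everywhere, as it is
    continuous without zeros. Then \<open>w\<close> would wind nonnegatively around
    \<open>0\<close>, whereas winding number \<open>1\<close> of \<gamma> forces \<open>-1\<close>
    for \<open>w\<close>.\<close>
  have neg: "\<kappa> s < 0" for s
  proof (rule ccontr)
    assume "\<not> \<kappa> s < 0"
    then have "0 < \<kappa> s" using \<kappa>0[of s] by simp
    have pos: "0 < \<kappa> t" for t
    proof (rule ccontr)
      assume "\<not> 0 < \<kappa> t"
      have "connected (range \<kappa>)" using cont\<kappa> by (intro connected_continuous_image) auto
      then have "0 \<in> range \<kappa>"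
        using \<open>0 < \<kappa> s\<close> \<open>\<not> 0 < \<kappa> t\<close> connectedD_interval[of "range \<kappa>" "\<kappa> t" "\<kappa> s" 0] by auto
      then show False using \<kappa>0 by (metis rangeE)
    qed
    define p where "p t = w (L * t)" for t
    have p': "(p has_vector_derivative L *\<^sub>R w' (L * t)) (at t)" for t
      unfolding p_def
      by (rule vector_diff_chain_at[OF _ w', unfolded o_def]) (auto intro!: derivative_eq_intros)
    have "p C1_differentiable_on UNIV"
      unfolding C1_differentiable_on_def
    proof (intro exI conjI ballI)
      show "continuous_on UNIV (\<lambda>t. L *\<^sub>R w' (L * t))"
        by (intro continuous_intros continuous_on_compose2[OF contw']) auto
    qed (rule p')
    then have valid: "valid_path p"
      unfolding valid_path_def by (meson C1_differentiable_imp_piecewise C1_differentiable_on_subset subset_UNIV)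
    have pim: "path_image p \<subseteq> sphere 0 1" using w(1) by (auto simp: path_image_def p_def)
    have "0 \<le> Re (winding_number p 0)"
    proof (rule winding_number_pos_le[OF valid])
      show "0 \<notin> path_image p" using pim by auto
      fix t :: real
      have "vector_derivative p (at t) * cnj (p t - 0) = of_real L * (w' (L * t) * cnj (w (L * t)))"
        using p'[of t] by (simp add: vector_derivative_at p_def scaleR_conv_of_real)
      then show "0 \<le> Im (vector_derivative p (at t) * cnj (p t - 0))"
        using L pos[of "L * t"] by (simp add: \<kappa>_def)
    qed
    moreover have "winding_number (\<lambda>t. phi c (p t)) 0 = - winding_number p 0"
    proof (rule winding_number_phi_path[OF valid_path_imp_path[OF valid] pim _ zero_interior_droplet[OF c]])
      show "pathfinish p = pathstart p"
        using per[of 0] by (simp add: pathfinish_def pathstart_def p_def w_def)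
    qed
    moreover have "winding_number (\<lambda>t. phi c (p t)) 0 = 1"
      using wind[OF zero_interior_droplet[OF c]] by (simp add: p_def w(2)[symmetric])
    ultimately have "winding_number p 0 = -1" by (metis minus_minus)
    then show False using \<open>0 \<le> Re (winding_number p 0)\<close> by simp
  qed
  have "D s = dphi c (w s) * w' s"
    using dphi_nonzero wS[of s] by (simp add: w'_def)
  also have "\<dots> = - \<i> * w s * dphi c (w s) / of_real (norm (dphi c (w s)))"
  proof -
    have "\<kappa> s = - (1 / norm (dphi c (w s)))" using neg[of s] abs\<kappa>[of s] by simp
    then show ?thesis by (simp add: w'_eq)
  qed
  finally have "vector_derivative \<gamma> (at s) = - \<i> * w s * dphi c (w s) / of_real (norm (dphi c (w s)))"
    by (simp only: D_def)
  then show ?thesis by (rule that[OF w])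
qed

text \<open>On the circle \<open>cnj w = 1 / w\<close>, and the norm of \<open>dphi c w\<close> is
  \<open>q * cnj q\<close>, so the conjugate tangent is \<open>\<i> * cnj w * cnj q / q\<close>.
  Everything is then rational in \<open>w\<close>.\<close>

lemma G_hat_boundary:
  assumes w: "w \<in> sphere 0 1"
  shows "G_hat c w = of_real (1 - c^4) * cnj (phi c w) +
    \<i> * of_real (6 * c^4 + 2) * cnj (- \<i> * w * dphi c w / of_real (norm (dphi c w)))"
proof -
  define q where "q = (1 + 3 * of_real (c^2) * w^2) / (w * (1 - of_real (c^2) * w^2))"
  have w0: "w \<noteq> 0" "w \<in> ball 0 (1 / (3 * c))" using sphere_radius[OF w] by auto
  note nz = denominators_nonzero[OF c w0(2)]
  have "norm w = 1" using w by simp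
  then have cw: "cnj w = 1 / w"
    using complex_norm_square[of w] w0(1) by (simp add: field_simps)
  \<comment> \<open>Up to the factor \<open>w^2\<close>, this is the conjugate of
    \<open>1 - c^2 w^2\<close> on the circle, the denominator of the conjugated terms.\<close>
  have nz': "w^2 - of_real (c^2) \<noteq> 0"
  proof
    assume "w^2 - of_real (c^2) = 0"
    then have "norm (w^2) = norm (complex_of_real (c^2))" by simp
    then have "c^2 = 1" using \<open>norm w = 1\<close> by (simp add: norm_power)
    then show False using c by (simp add: power2_eq_1_iff)
  qed
  have q0: "q \<noteq> 0" using nz w0 by (simp add: q_def)
  have dq: "dphi c w = q^2" unfolding dphi_def q_def ..
  have "complex_of_real (norm (dphi c w)) = of_real ((norm q)^2)"
    by (simp only: dq norm_power)
  also have "\<dots> = q * cnj q" by (rule complex_norm_square)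
  finally have "complex_of_real (norm (dphi c w)) = q * cnj q" .
  then have t: "cnj (- \<i> * w * dphi c w / of_real (norm (dphi c w))) = \<i> * cnj w * cnj q / q"
    using q0 by (simp add: dq power2_eq_square)
  have nz'': "1 - of_real (c^2) * (1/w)^2 \<noteq> 0" using nz' w0 by (simp add: field_simps)
  have cq: "cnj q = w * (w^2 + 3 * of_real (c^2)) / (w^2 - of_real (c^2))"
    using nz' nz'' w0 by (simp add: q_def cw divide_simps power2_eq_square)
  have cphi: "cnj (phi c w) = w * (9 * of_real (c^2) - w^2) / (w^2 - of_real (c^2))"
    using nz' nz'' w0
    by (simp add: phi_closed_form[OF c w0(2,1)] cw divide_simps power2_eq_square)
  define C where "C = complex_of_real (c^2)"
  have C2: "complex_of_real (c^4) = C^2" by (simp add: C_def)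
  define d n m where "d = w^2 - C" and "n = 1 + 3 * C * w^2" and "m = 1 - C * w^2"
  have dnm: "d \<noteq> 0" "n \<noteq> 0" "m \<noteq> 0"
    using nz nz' by (simp_all add: d_def n_def m_def C_def)
  \<comment> \<open>The numerators over the common denominator \<open>d * n\<close>, with a factor
    \<open>w\<close> removed. The values of \<open>p\<close> and \<tau> are what makes this an
    identity.\<close>
  have poly: "(9 * C^2 - 1) * (3 + C * w^2) * d =
      (1 - C^2) * (9 * C - w^2) * n - (6 * C^2 + 2) * (w^2 + 3 * C) * m"
    unfolding d_def n_def m_def by (simp add: algebra_simps power2_eq_square)
  have "\<i> * (6 * C^2 + 2) * (\<i> * (1 / w) * (w * (w^2 + 3 * C) / d) / (n / (w * m))) =
      - ((6 * C^2 + 2) * (w^2 + 3 * C) * m) * w / (d * n)"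
    using dnm w0(1) by (simp add: field_simps)
  then have "(1 - C^2) * (w * (9 * C - w^2) / d) +
      \<i> * (6 * C^2 + 2) * (\<i> * (1 / w) * (w * (w^2 + 3 * C) / d) / (n / (w * m))) =
    (9 * C^2 - 1) * (3 + C * w^2) * d * w / (d * n)"
    unfolding poly using dnm w0(1) by (simp add: field_simps)
  also have "\<dots> = (9 * C^2 - 1) * (w * (3 + C * w^2) / n)"
    using dnm by simp
  also have "\<dots> = G_hat c w"
    by (simp add: G_hat_def n_def C2 C_def)
  finally have "G_hat c w = (1 - C^2) * (w * (9 * C - w^2) / d) +
      \<i> * (6 * C^2 + 2) * (\<i> * (1 / w) * (w * (w^2 + 3 * C) / d) / (n / (w * m)))" ..
  moreover have "of_real (1 - c^4) = 1 - C^2" "of_real (6 * c^4 + 2) = 6 * C^2 + 2"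
    by (simp_all add: C_def)
  ultimately show ?thesis
    unfolding t cphi cq cw unfolding q_def by (simp only: C_def d_def n_def m_def)
qed

end

section \<open>Arc length parametrization\<close>

text \<open>For a curve of speed \<open>f\<close>, its primitive \<open>S\<close> is the arc length
  and \<Theta> is the inverse of \<open>S\<close>. Periodicity of \<open>f\<close> makes
  \<open>S (x + T) - S x\<close> constant, and this constant is the length \<open>L\<close>.\<close>

lemma periodic_arclength_parameter:
  fixes f :: "real \<Rightarrow> real"
  assumes cont: "continuous_on UNIV f" and pos: "\<And>x. 0 < f x"
    and per: "\<And>x. f (x + T) = f x" and T: "0 < T"
  obtains L \<Theta> where "0 < L" "\<And>s. (\<Theta> has_real_derivative inverse (f (\<Theta> s))) (at s)"
    "\<And>s. \<Theta> (s + L) = \<Theta> s + T" "bij_betw \<Theta> {0..<L} {0..<T}" "\<Theta> 0 = 0"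
proof -
  define S where "S x = (LBINT y=ereal 0..ereal x. f y)" for x :: real
  have S': "(S has_real_derivative f x) (at x)" for x
  proof -
    have "((\<lambda>u. LBINT y=ereal 0..ereal u. f y) has_vector_derivative f x)
        (at x within {min 0 x - 1..max 0 x + 1})"
      by (rule interval_integral_FTC2) (auto intro: continuous_on_subset[OF cont])
    then have "(S has_vector_derivative f x) (at x)"
      by (subst (asm) at_within_Icc_at) (auto simp: S_def[abs_def])
    then show ?thesis by (simp add: has_real_derivative_iff_has_vector_derivative)
  qed
  have S0: "S 0 = 0" by (simp add: S_def)
  have mono: "S x < S y" if "x < y" for x y
    using DERIV_pos_imp_increasing[OF that, of S] S' pos by blast
  define L where "L = S T"
  have L: "0 < L" using mono[OF T] by (simp add: L_def S0)
  have SL: "S (x + T) = S x + L" for x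
  proof -
    have "((\<lambda>x. S (x + T) - S x) has_real_derivative 0) (at y)" for y
    proof -
      have "((\<lambda>x. S (x + T)) has_real_derivative f (y + T)) (at y)"
        using S' DERIV_shift by blast
      then show ?thesis
        using S'[of y] by (auto intro!: derivative_eq_intros simp: per)
    qed
    then have "S (x + T) - S x = S (0 + T) - S 0"
      by (intro DERIV_isconst_all[rule_format]) auto
    then show ?thesis by (simp add: S0 L_def)
  qed
  have contS: "continuous_on A S" for A
    using S' by (meson DERIV_isCont continuous_at_imp_continuous_on)
  \<comment> \<open>Whole periods show that \<open>S\<close> is unbounded in both directions, hence
    onto by the intermediate value theorem.\<close>
  have Sn: "S (real n * T) = real n * L" "S (- (real n * T)) = - (real n * L)" for n
  proof (induction n)
    case (Suc n)
    show "S (real (Suc n) * T) = real (Suc n) * L"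
      using SL[of "real n * T"] Suc by (simp add: algebra_simps)
    show "S (- (real (Suc n) * T)) = - (real (Suc n) * L)"
      using SL[of "- (real (Suc n) * T)"] Suc by (simp add: algebra_simps)
  qed (auto simp: S0)
  have "\<exists>x. S x = s" for s
  proof -
    obtain n where n: "\<bar>s\<bar> / L \<le> real n" using real_arch_simple by blast
    then have "- (real n * L) \<le> s" "s \<le> real n * L" using L by (auto simp: field_simps abs_le_iff)
    then show ?thesis
      using IVT'[of S "- (real n * T)" s "real n * T"] Sn[of n] T contS by auto
  qed
  then obtain \<Theta> where \<Theta>: "\<And>s. S (\<Theta> s) = s" by metis
  have \<Theta>S: "\<Theta> (S x) = x" for x
    using \<Theta>[of "S x"] mono by (metis linorder_neqE_linordered_idom less_irrefl)
  have less_iff: "S x < S y \<longleftrightarrow> x < y" for x y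
    using mono by (metis linorder_neqE_linordered_idom less_asym less_irrefl)
  show ?thesis
  proof (rule that[OF L])
    fix s
    have "(\<Theta> has_real_derivative inverse (f (\<Theta> s))) (at (S (\<Theta> s)))"
      using S' pos[of "\<Theta> s"] \<Theta>S contS by (intro has_field_derivative_inverse_strong[of S _ _ UNIV]) auto
    then show "(\<Theta> has_real_derivative inverse (f (\<Theta> s))) (at s)" by (simp add: \<Theta>)
    show "\<Theta> (s + L) = \<Theta> s + T" using SL[of "\<Theta> s"] \<Theta>S by (metis \<Theta>)
  next
    have "S x \<in> {0..<L} \<longleftrightarrow> x \<in> {0..<T}" for x
      using less_iff[of x 0] less_iff[of x T] by (auto simp: S0 L_def not_less[symmetric])
    then show "bij_betw \<Theta> {0..<L} {0..<T}"
      using \<Theta> \<Theta>S by (intro bij_betw_byWitness[where f' = S]) (auto, (metis \<Theta> atLeastLessThan_iff)+)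
    show "\<Theta> 0 = 0" using \<Theta>S[of 0] by (simp add: S0)
  qed
qed

text \<open>The minus sign makes the circle run clockwise; the pole of \<open>phi c\<close> inside
  it reverses this, so the boundary of the droplet is traversed counterclockwise.\<close>

lemma exp_circle_periodic: "exp (- \<i> * of_real (\<theta> + 2 * pi)) = exp (- \<i> * of_real \<theta>)"
proof -
  have "- \<i> * of_real (\<theta> + 2 * pi) = - \<i> * of_real \<theta> - of_real (2 * pi) * \<i>"
    by (simp add: algebra_simps)
  then show ?thesis
    by (simp only: exp_diff) (simp add: exp_two_pi_i')
qed

lemma exp_circle_eq_iff:
  assumes "x \<in> {0..<2*pi}" "y \<in> {0..<2*pi}" "exp (- \<i> * of_real x) = exp (- \<i> * of_real y)"
  shows "x = y"
proof -
  have "\<bar>y - x\<bar> < 2 * pi" using assms(1,2) by auto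
  then have "- \<i> * of_real x = - \<i> * of_real y"
    by (intro exp_complex_eqI[OF _ assms(3)]) (simp add: abs_minus_commute)
  then show ?thesis by simp
qed

lemma sphere_exp_circle:
  assumes "w \<in> sphere 0 1"
  obtains x where "x \<in> {0..<2*pi}" "w = exp (- \<i> * of_real x)"
proof
  show "Arg2pi (cnj w) \<in> {0..<2*pi}" by (simp add: Arg2pi_ge_0 Arg2pi_lt_2pi)
  have "cnj w = exp (\<i> * of_real (Arg2pi (cnj w)))"
    using Arg2pi_eq[of "cnj w"] assms by simp
  then have "w = cnj (exp (\<i> * of_real (Arg2pi (cnj w))))" by (metis complex_cnj_cnj)
  then show "w = exp (- \<i> * of_real (Arg2pi (cnj w)))" by (simp add: exp_cnj)
qed

context
  fixes c :: real
  assumes c: "0 < c" "c < 1/3"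
begin

lemma phi_circle_has_vector_derivative:
  "((\<lambda>\<theta>. phi c (exp (- \<i> * of_real \<theta>))) has_vector_derivative
     - \<i> * exp (- \<i> * of_real \<theta>) * dphi c (exp (- \<i> * of_real \<theta>))) (at \<theta>)"
proof -
  have "exp (- \<i> * of_real \<theta>) \<in> sphere 0 1" by simp
  then have "(phi c has_field_derivative dphi c (exp (- \<i> * of_real \<theta>))) (at (exp (- \<i> * of_real \<theta>)))"
    unfolding dphi_def using sphere_radius[OF c] by (intro phi_has_field_derivative[OF c]) blast+
  moreover have "((\<lambda>\<theta>. exp (- \<i> * of_real \<theta>)) has_vector_derivative
      - \<i> * exp (- \<i> * of_real \<theta>)) (at \<theta>)"
    by (rule has_vector_derivative_real_field) (auto intro!: derivative_eq_intros)
  ultimately show ?thesis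
    using field_vector_diff_chain_at[unfolded o_def] by blast
qed

text \<open>Without it, the equation for \<open>G\<close>, which is claimed for every arc length
  parametrization, could hold vacuously. The curve is the image of the clockwise circle,
  reparametrized by \<open>periodic_arclength_parameter\<close>.\<close>

lemma exists_arclength_boundary: "\<exists>L \<gamma>. arclength_boundary (droplet (Omega c)) L \<gamma>"
proof -
  define e where "e \<theta> = exp (- \<i> * of_real \<theta>)" for \<theta> :: real
  have e: "e \<theta> \<in> sphere 0 1" for \<theta> by (simp add: e_def)
  have cont_e: "continuous_on A e" for A unfolding e_def by (intro continuous_intros)
  define f where "f \<theta> = norm (dphi c (e \<theta>))" for \<theta>
  have pos: "0 < f \<theta>" for \<theta>
    using dphi_nonzero[OF c] sphere_radius[OF c e] by (simp add: f_def)
  have cont_dphi_e: "continuous_on UNIV (\<lambda>\<theta>. dphi c (e \<theta>))"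
    using cont_e e by (intro continuous_on_compose2[OF continuous_dphi[OF c]]) auto
  then have contf: "continuous_on UNIV f"
    unfolding f_def by (intro continuous_intros)
  have e2pi: "e (\<theta> + 2 * pi) = e \<theta>" for \<theta>
    unfolding e_def by (rule exp_circle_periodic)
  obtain L \<Theta> where L: "0 < L" and \<Theta>': "\<And>s. (\<Theta> has_real_derivative inverse (f (\<Theta> s))) (at s)"
    and per: "\<And>s. \<Theta> (s + L) = \<Theta> s + 2 * pi" and bij: "bij_betw \<Theta> {0..<L} {0..<2*pi}"
    and \<Theta>0: "\<Theta> 0 = 0"
    using periodic_arclength_parameter[of f "2 * pi"] contf pos e2pi by (auto simp: f_def)
  have cont\<Theta>: "continuous_on A \<Theta>" for A
    using \<Theta>' by (meson DERIV_isCont continuous_at_imp_continuous_on)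
  define \<gamma> where "\<gamma> s = phi c (e (\<Theta> s))" for s
  define D where "D s = inverse (f (\<Theta> s)) *\<^sub>R (- \<i> * e (\<Theta> s) * dphi c (e (\<Theta> s)))" for s
  have D: "(\<gamma> has_vector_derivative D s) (at s)" for s
    unfolding D_def \<gamma>_def e_def
    by (rule vector_diff_chain_at[OF _ phi_circle_has_vector_derivative, unfolded o_def])
      (use \<Theta>'[of s] in \<open>simp add: has_real_derivative_iff_has_vector_derivative e_def\<close>)
  have "continuous_on UNIV D"
    unfolding D_def using pos[THEN less_imp_neq]
    by (intro continuous_intros continuous_on_compose2[OF contf cont\<Theta>]
      continuous_on_compose2[OF cont_e cont\<Theta>] continuous_on_compose2[OF cont_dphi_e cont\<Theta>]) auto
  then have C1: "\<gamma> C1_differentiable_on UNIV"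
    unfolding C1_differentiable_on_def using D by blast
  have unit: "norm (vector_derivative \<gamma> (at s)) = 1" for s
  proof -
    have "norm (D s) = inverse (f (\<Theta> s)) * (norm (e (\<Theta> s)) * f (\<Theta> s))"
      using pos[of "\<Theta> s"] unfolding D_def by (simp add: norm_mult f_def)
    then show ?thesis
      using pos[of "\<Theta> s"] e[of "\<Theta> s"] vector_derivative_at[OF D[of s]] by simp
  qed
  have \<gamma>L: "\<gamma> (s + L) = \<gamma> s" for s by (simp add: \<gamma>_def per e2pi)
  have inj: "inj_on \<gamma> {0..<L}"
  proof (rule inj_onI)
    fix a b assume ab: "a \<in> {0..<L}" "b \<in> {0..<L}" "\<gamma> a = \<gamma> b"
    then have "e (\<Theta> a) = e (\<Theta> b)"
      using inj_onD[OF phi_inj[OF c]] sphere_radius[OF c e] by (auto simp: \<gamma>_def)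
    moreover have "\<Theta> a \<in> {0..<2*pi}" "\<Theta> b \<in> {0..<2*pi}" using ab bij bij_betwE by blast+
    ultimately have "\<Theta> a = \<Theta> b" using exp_circle_eq_iff by (simp add: e_def)
    then show "a = b" using ab bij by (meson bij_betw_imp_inj_on inj_onD)
  qed
  have im: "\<gamma> ` {0..<L} = frontier (droplet (Omega c))"
  proof -
    have "e ` {0..<2*pi} = sphere 0 1"
      using e sphere_exp_circle by (fastforce simp: e_def)
    moreover have "\<gamma> ` {0..<L} = phi c ` e ` \<Theta> ` {0..<L}" by (auto simp: \<gamma>_def)
    ultimately show ?thesis
      using bij by (simp add: frontier_droplet[OF c] bij_betw_imp_surj_on)
  qed
  have wind: "winding_number (\<lambda>t. \<gamma> (L * t)) z = 1" if z: "z \<in> interior (droplet (Omega c))" for z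
  proof -
    \<comment> \<open>A continuous logarithm of the clockwise circle over one period: its increment
      is \<open>-2 * pi * \<i>\<close>, whence the winding number \<open>-1\<close>.\<close>
    define q where "q t = - \<i> * of_real (\<Theta> (L * t))" for t
    have "\<Theta> L = 2 * pi" using per[of 0] by (simp add: \<Theta>0)
    have "path q"
      unfolding path_def q_def by (intro continuous_intros continuous_on_compose2[OF cont\<Theta>]) auto
    then have "winding_number (exp \<circ> q) 0 = -1"
      by (simp add: winding_number_compose_exp pathfinish_def pathstart_def q_def \<open>\<Theta> L = 2 * pi\<close> \<Theta>0)
    moreover have "winding_number (\<lambda>t. phi c ((exp \<circ> q) t)) z = - winding_number (exp \<circ> q) 0"
    proof (rule winding_number_phi_path[OF c _ _ _ z])
      show "path (exp \<circ> q)"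
        using \<open>path q\<close> unfolding path_def o_def by (intro continuous_intros)
      show "path_image (exp \<circ> q) \<subseteq> sphere 0 1"
        by (auto simp: path_image_def q_def)
      show "pathfinish (exp \<circ> q) = pathstart (exp \<circ> q)"
        using e2pi[of 0] by (simp add: pathfinish_def pathstart_def q_def e_def \<open>\<Theta> L = 2 * pi\<close> \<Theta>0)
    qed
    ultimately show ?thesis by (simp add: \<gamma>_def e_def q_def)
  qed
  have "arclength_boundary (droplet (Omega c)) L \<gamma>"
    unfolding arclength_boundary_def using L C1 unit \<gamma>L inj im wind by blast
  then show ?thesis by blast
qed

end

section \<open>Convexity\<close>

text \<open>For a point \<open>y\<close> of the hull outside \<open>K\<close>, the segment from
  \<open>z0\<close> to \<open>y\<close> meets the frontier at some \<open>x\<close> before reaching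
  \<open>y\<close>. The supporting half-space at \<open>x\<close> contains \<open>y\<close>, and
  \<open>z0\<close> strictly, so it would contain \<open>x\<close> strictly, which is
  absurd.\<close>

lemma convex_if_supported_at_frontier:
  fixes K :: "'a::euclidean_space set"
  assumes K: "compact K" and o: "z0 \<in> interior K"
    and supp: "\<And>x. x \<in> frontier K \<Longrightarrow> \<exists>a. a \<noteq> 0 \<and> (\<forall>y\<in>frontier K. a \<bullet> y \<le> a \<bullet> x)"
  shows "convex K"
proof -
  \<comment> \<open>A nonzero linear functional has no maximum over \<open>K\<close> at an interior
    point, so a half-space containing the frontier contains all of \<open>K\<close>.\<close>
  have push: "\<exists>y\<in>K. a \<bullet> x < a \<bullet> y" if x: "x \<in> interior K" and a: "a \<noteq> 0" for a x
  proof -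
    obtain e where e: "e > 0" "cball x e \<subseteq> K" using x by (auto simp: mem_interior_cball)
    have "x + (e / norm a) *\<^sub>R a \<in> K" using e a by (intro subsetD[OF e(2)]) (simp add: dist_norm)
    moreover have "a \<bullet> x < a \<bullet> (x + (e / norm a) *\<^sub>R a)"
      using e(1) a by (simp add: inner_add_right)
    ultimately show ?thesis by blast
  qed
  have suppK: "\<exists>a. a \<noteq> 0 \<and> (\<forall>y\<in>K. a \<bullet> y \<le> a \<bullet> x)" if x: "x \<in> frontier K" for x
  proof -
    obtain a where a: "a \<noteq> 0" "\<And>y. y \<in> frontier K \<Longrightarrow> a \<bullet> y \<le> a \<bullet> x" using supp[OF x] by blast
    have "continuous_on K ((\<bullet>) a)" by (intro continuous_intros)
    moreover have "K \<noteq> {}" using o interior_subset by blast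
    ultimately obtain m where m: "m \<in> K" "\<And>y. y \<in> K \<Longrightarrow> a \<bullet> y \<le> a \<bullet> m"
      using continuous_attains_sup[OF K] by blast
    have "m \<notin> interior K" using push[OF _ a(1)] m(2) by (meson not_le)
    then have "m \<in> frontier K" using m(1) closure_subset by (auto simp: frontier_def)
    then show ?thesis using a m(2) by (meson order_trans)
  qed
  have "convex hull K \<subseteq> K"
  proof (rule ccontr)
    assume "\<not> convex hull K \<subseteq> K"
    then obtain y where y: "y \<in> convex hull K" "y \<notin> K" by blast
    have "closed_segment z0 y \<inter> frontier K \<noteq> {}"
      using y(2) o interior_subset by (intro connected_Int_frontier) auto
    then obtain x where x: "x \<in> closed_segment z0 y" "x \<in> frontier K" by blast
    then obtain t where t: "0 \<le> t" "t \<le> 1" "x = (1 - t) *\<^sub>R z0 + t *\<^sub>R y" by (auto simp: in_segment)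
    have "x \<in> K" using x(2) frontier_subset_closed[OF compact_imp_closed[OF K]] by blast
    then have "t \<noteq> 1" using t(3) y(2) by auto
    obtain a where a: "a \<noteq> 0" "\<And>y. y \<in> K \<Longrightarrow> a \<bullet> y \<le> a \<bullet> x" using suppK[OF x(2)] by blast
    have "convex hull K \<subseteq> {v. a \<bullet> v \<le> a \<bullet> x}"
      using a(2) by (intro hull_minimal) (auto simp: convex_halfspace_le)
    then have "a \<bullet> y \<le> a \<bullet> x" using y(1) by blast
    moreover have "a \<bullet> z0 < a \<bullet> x" using push[OF o a(1)] a(2) by fastforce
    ultimately have "(1 - t) * (a \<bullet> z0) + t * (a \<bullet> y) < (1 - t) * (a \<bullet> x) + t * (a \<bullet> x)"
      using t(1,2) \<open>t \<noteq> 1\<close> by (intro add_less_le_mono mult_strict_left_mono mult_left_mono) auto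
    then show False by (simp add: t(3) inner_add_right algebra_simps)
  qed
  then have "convex hull K = K" by (intro equalityI hull_subset)
  then show ?thesis using convex_convex_hull[of K] by simp
qed

text \<open>With \<open>F\<close> the height of a closed curve in the direction of its outward normal at \<open>\<theta>\<^sub>0\<close> and
  \<open>\<eta>\<close> its tangent angle, \<open>F\<close> first decreases and then increases back to its initial value.\<close>

lemma height_le_if_angle_mono:
  fixes F \<eta> r :: "real \<Rightarrow> real"
  assumes F': "\<And>\<theta>. (F has_real_derivative - r \<theta> * sin (\<eta> \<theta> - \<eta> \<theta>0)) (at \<theta>)"
    and r: "\<And>\<theta>. 0 \<le> r \<theta>" and mono: "mono \<eta>"
    and \<eta>: "\<eta> (\<theta>0 + T) = \<eta> \<theta>0 + 2 * pi" and F: "F (\<theta>0 + T) = F \<theta>0"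
    and \<theta>: "\<theta>0 \<le> \<theta>" "\<theta> \<le> \<theta>0 + T"
  shows "F \<theta> \<le> F \<theta>0"
proof (cases "\<eta> \<theta> - \<eta> \<theta>0 \<le> pi")
  case True
  show ?thesis
  proof (rule DERIV_nonpos_imp_nonincreasing[OF \<theta>(1)])
    fix x assume x: "\<theta>0 \<le> x" "x \<le> \<theta>"
    have "0 \<le> sin (\<eta> x - \<eta> \<theta>0)"
      using monoD[OF mono x(1)] monoD[OF mono x(2)] True by (intro sin_ge_zero) auto
    then show "\<exists>y. (F has_real_derivative y) (at x) \<and> y \<le> 0"
      using F' r by (intro exI conjI) (auto intro: mult_nonneg_nonneg)
  qed
next
  case False
  have "F \<theta> \<le> F (\<theta>0 + T)"
  proof (rule DERIV_nonneg_imp_nondecreasing[OF \<theta>(2)])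
    fix x assume x: "\<theta> \<le> x" "x \<le> \<theta>0 + T"
    have "0 \<le> sin (\<eta> x - \<eta> \<theta>0 - pi)"
      using monoD[OF mono x(1)] monoD[OF mono x(2)] False \<eta> by (intro sin_ge_zero) auto
    then have "sin (\<eta> x - \<eta> \<theta>0) \<le> 0" by (simp add: sin_diff[of _ pi])
    then have "r x * sin (\<eta> x - \<eta> \<theta>0) \<le> 0" using r by (intro mult_nonneg_nonpos)
    then show "\<exists>y. (F has_real_derivative y) (at x) \<and> 0 \<le> y"
      using F' by (intro exI conjI) auto
  qed
  then show ?thesis by (simp add: F)
qed

text \<open>The left-hand side is largest at \<open>u = \<rho>\<close>, where the inequality reads \<open>3 \<rho>\<^sup>2 + 14 \<rho> \<le> 1\<close>; this is
  where \<open>c1\<close> comes from, with \<open>\<rho> = c\<^sup>2\<close>.\<close>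

lemma curvature_inequality:
  fixes u :: complex
  assumes u: "norm u = \<rho>" and \<rho>: "\<rho> < 1/3" "3 * \<rho>^2 + 14 * \<rho> \<le> 1"
  shows "16 * Re (u / ((1 + 3 * u) * (1 - u))) \<le> 1"
proof -
  define x where "x = Re u"
  define V where "V = (1 + 3 * u) * (1 - u)"
  have "0 \<le> \<rho>" using u by auto
  have x: "\<bar>x\<bar> \<le> \<rho>" unfolding x_def u[symmetric] by (rule abs_Re_le_cmod)
  have uu: "x^2 + (Im u)^2 = \<rho>^2" using u cmod_power2[of u] by (simp add: x_def)
  then have y2: "(Im u)^2 = \<rho>^2 - x^2" by simp
  have V0: "V \<noteq> 0"
  proof
    assume "V = 0"
    then have "3 * u = -1 \<or> u = 1" by (auto simp: V_def add_eq_0_iff)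
    then have "norm (3 * u) = 1 \<or> norm u = 1" by (metis norm_minus_cancel norm_one)
    then show False using u \<rho>(1) by (auto simp: norm_mult)
  qed
  have "(norm V)^2 - 16 * Re (u * cnj V) =
      - (12 * x^2 + (12 - 36 * \<rho>^2) * x - 1 + 22 * \<rho>^2 - 9 * \<rho>^4)"
  proof -
    have N: "(norm V)^2 = ((1 + 3 * x)^2 + 9 * (Im u)^2) * ((1 - x)^2 + (Im u)^2)"
      unfolding V_def norm_mult power_mult_distrib cmod_power2 by (simp add: x_def power_mult_distrib)
    have R: "Re (u * cnj V) = x * (1 + 2 * x - 3 * x^2 + 3 * (Im u)^2) + (Im u)^2 * (2 - 6 * x)"
      by (simp add: V_def x_def algebra_simps power2_eq_square)
    show ?thesis unfolding N R y2 by (simp add: algebra_simps eval_nat_numeral)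
  qed
  \<comment> \<open>The first summand is the value at \<open>x = \<rho>\<close>; the second is the
    remaining difference, nonnegative because \<bar>x\<bar> \<le> \<rho>.\<close>
  also have "\<dots> = (1 - 14 * \<rho> - 3 * \<rho>^2) * ((1 + 3 * \<rho>) * (1 - \<rho>)) +
      12 * (\<rho> - x) * ((\<rho> + x) + (1 - 3 * \<rho>^2))"
    by (simp add: algebra_simps eval_nat_numeral)
  also have "\<dots> \<ge> 0"
  proof -
    have "3 * \<rho>^2 \<le> 1" using \<open>0 \<le> \<rho>\<close> \<rho>(2) by simp
    then have "0 \<le> (1 - 14 * \<rho> - 3 * \<rho>^2) * ((1 + 3 * \<rho>) * (1 - \<rho>))"
      using \<open>0 \<le> \<rho>\<close> \<rho> by (intro mult_nonneg_nonneg) linarith+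
    moreover have "0 \<le> 12 * (\<rho> - x) * ((\<rho> + x) + (1 - 3 * \<rho>^2))"
      using \<open>3 * \<rho>^2 \<le> 1\<close> x by (intro mult_nonneg_nonneg) linarith+
    ultimately show ?thesis by linarith
  qed
  finally have "16 * Re (u * cnj V) \<le> (norm V)^2" by simp
  then have "16 * Re (u * cnj V) / (norm V)^2 \<le> 1"
    using V0 by (simp add: divide_le_eq_1)
  moreover have "Re (u / V) = Re (u * cnj V) / (norm V)^2"
    by (simp add: Re_divide cmod_power2)
  ultimately show ?thesis
    by (simp add: V_def[symmetric])
qed

section \<open>Tangent angle and supporting lines of the droplet\<close>

context
  fixes c :: real
  assumes c: "0 < c" "c < 1/3"
begin

text \<open>The velocity of the boundary curve at \<theta> is \<open>- \<i> * (norm (A \<theta>))^2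
  * exp (\<i> * \<eta> \<theta>)\<close>. By \<open>curvature_inequality\<close> the angle \<eta> is
  nondecreasing, so \<open>height_le_if_angle_mono\<close> applies to the height along the normal at
  \<open>w0\<close>.\<close>

lemma droplet_support:
  assumes cc: "3 * c^4 + 14 * c^2 \<le> 1" and w0: "w0 \<in> sphere 0 1"
  shows "\<exists>a. a \<noteq> 0 \<and> (\<forall>w\<in>sphere 0 1. a \<bullet> phi c w \<le> a \<bullet> phi c w0)"
proof -
  define e where "e \<theta> = exp (- \<i> * of_real \<theta>)" for \<theta> :: real
  define u where "u \<theta> = of_real (c^2) * (e \<theta>)^2" for \<theta>
  have e: "e \<theta> \<in> sphere 0 1" for \<theta> by (simp add: e_def)
  have c2: "c^2 < 1/3"
    using mult_strict_mono[OF c(2) c(2)] c(1) by (simp add: power2_eq_square)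
  have nu: "norm (u \<theta>) = c^2" for \<theta>
    using e[of \<theta>] by (simp add: u_def norm_mult norm_power)
  have Reu: "\<bar>Re (u \<theta>)\<bar> \<le> c^2" for \<theta> using abs_Re_le_cmod[of "u \<theta>"] by (simp add: nu)
  have nz: "1 + 3 * u \<theta> \<noteq> 0" "1 - u \<theta> \<noteq> 0" for \<theta>
    using Reu[of \<theta>] c2 by (auto simp: complex_eq_iff)
  define A where "A \<theta> = (1 + 3 * u \<theta>) / (1 - u \<theta>)" for \<theta>
  \<comment> \<open>Positive real part keeps \<open>A\<close> off the branch cut of
    \<open>Ln\<close>. The argument of \<open>A\<close> is then smooth and periodic, so \<eta> gains
    exactly \<open>2 * pi\<close> per period.\<close>
  have A_pos: "0 < Re (A \<theta>)" for \<theta>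
  proof -
    have n2: "(Re (u \<theta>))^2 + (Im (u \<theta>))^2 = (c^2)^2"
      using cmod_power2[of "u \<theta>"] by (simp add: nu)
    have "3 * (c^2)^2 < c^2" using c2 c by (simp add: power2_eq_square)
    have "Re ((1 + 3 * u \<theta>) * cnj (1 - u \<theta>)) = 1 + 2 * Re (u \<theta>) - 3 * (c^2)^2"
      unfolding n2[symmetric] by (simp add: algebra_simps power2_eq_square)
    also have "\<dots> > 0" using Reu[of \<theta>] c2 \<open>3 * (c^2)^2 < c^2\<close> by auto
    finally show ?thesis
      using nz[of \<theta>] by (simp add: A_def Re_complex_div_gt_0)
  qed
  have A0: "A \<theta> \<noteq> 0" for \<theta> using A_pos[of \<theta>] by auto
  define \<eta> where "\<eta> \<theta> = \<theta> + 2 * Im (Ln (A \<theta>))" for \<theta>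
  have u': "(u has_vector_derivative - 2 * \<i> * u \<theta>) (at \<theta>)" for \<theta>
    unfolding u_def e_def
    by (rule has_vector_derivative_real_field)
       (auto intro!: derivative_eq_intros simp: power2_eq_square)
  have \<eta>': "(\<eta> has_real_derivative 1 - 16 * Re (u \<theta> / ((1 + 3 * u \<theta>) * (1 - u \<theta>)))) (at \<theta>)" for \<theta>
  proof -
    define z where "z = u \<theta>"
    have "((\<lambda>z. Ln ((1 + 3 * z) / (1 - z))) has_field_derivative 4 / ((1 + 3 * z) * (1 - z))) (at z)"
    proof -
      have "(1 + 3 * z) / (1 - z) \<notin> \<real>\<^sub>\<le>\<^sub>0"
        using A_pos[of \<theta>] by (auto simp: z_def A_def complex_nonpos_Reals_iff)
      then show ?thesis
        using nz[of \<theta>] unfolding z_def[symmetric]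
        by (auto intro!: derivative_eq_intros simp: divide_simps)
    qed
    from field_vector_diff_chain_at[OF u' this[unfolded z_def]]
    have "((\<lambda>\<theta>. Ln (A \<theta>)) has_vector_derivative
        - 2 * \<i> * u \<theta> * (4 / ((1 + 3 * u \<theta>) * (1 - u \<theta>)))) (at \<theta>)"
      by (simp add: o_def A_def)
    then have "((\<lambda>\<theta>. Im (Ln (A \<theta>))) has_vector_derivative
        Im (- 2 * \<i> * u \<theta> * (4 / ((1 + 3 * u \<theta>) * (1 - u \<theta>))))) (at \<theta>)"
      by (rule bounded_linear.has_vector_derivative[OF bounded_linear_Im])
    moreover have "Im (- 2 * \<i> * u \<theta> * (4 / ((1 + 3 * u \<theta>) * (1 - u \<theta>)))) =
        - 8 * Re (u \<theta> / ((1 + 3 * u \<theta>) * (1 - u \<theta>)))"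
    proof -
      define Z where "Z = u \<theta> / ((1 + 3 * u \<theta>) * (1 - u \<theta>))"
      have "- 2 * \<i> * u \<theta> * (4 / ((1 + 3 * u \<theta>) * (1 - u \<theta>))) = - 8 * \<i> * Z"
        by (simp add: Z_def)
      also have "Im (- 8 * \<i> * Z) = - 8 * Re Z" by simp
      finally show ?thesis by (simp only: Z_def)
    qed
    ultimately have "((\<lambda>\<theta>. Im (Ln (A \<theta>))) has_real_derivative
        - 8 * Re (u \<theta> / ((1 + 3 * u \<theta>) * (1 - u \<theta>)))) (at \<theta>)"
      by (simp only: has_real_derivative_iff_has_vector_derivative)
    from DERIV_add[OF DERIV_ident DERIV_cmult[OF this, of 2]] show ?thesis
      by (simp add: \<eta>_def[abs_def])
  qed
  have mono: "mono \<eta>"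
  proof (rule monoI)
    fix x y :: real assume "x \<le> y"
    then show "\<eta> x \<le> \<eta> y"
    proof (rule DERIV_nonneg_imp_nondecreasing)
      fix \<theta>
      have "16 * Re (u \<theta> / ((1 + 3 * u \<theta>) * (1 - u \<theta>))) \<le> 1"
        using nu c2 cc by (intro curvature_inequality[of _ "c^2"]) auto
      then show "\<exists>d. (\<eta> has_real_derivative d) (at \<theta>) \<and> 0 \<le> d"
        using \<eta>'[of \<theta>] by (intro exI conjI) auto
    qed
  qed
  have e2pi: "e (\<theta> + 2 * pi) = e \<theta>" for \<theta>
    unfolding e_def by (rule exp_circle_periodic)
  have \<eta>2pi: "\<eta> (\<theta> + 2 * pi) = \<eta> \<theta> + 2 * pi" for \<theta>
    by (simp add: \<eta>_def A_def u_def e2pi)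
  obtain \<theta>0 where \<theta>0: "\<theta>0 \<in> {0..<2*pi}" "w0 = e \<theta>0"
    using sphere_exp_circle[OF w0] by (auto simp: e_def)
  \<comment> \<open>The outward normal at \<theta>0: the tangent direction
    \<open>- \<i> * exp (\<i> * \<eta> \<theta>0)\<close> turned by a right angle clockwise.\<close>
  define a where "a = - exp (\<i> * of_real (\<eta> \<theta>0))"
  define F where "F \<theta> = a \<bullet> phi c (e \<theta>)" for \<theta>
  have F': "(F has_real_derivative (- ((norm (A \<theta>))^2) * sin (\<eta> \<theta> - \<eta> \<theta>0))) (at \<theta>)" for \<theta>
  proof -
    have "(F has_vector_derivative a \<bullet> (- \<i> * e \<theta> * dphi c (e \<theta>))) (at \<theta>)"
      unfolding F_def using phi_circle_has_vector_derivative[OF c, of \<theta>]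
      by (intro bounded_linear.has_vector_derivative[OF bounded_linear_inner_right]) (simp add: e_def)
    moreover have "a \<bullet> (- \<i> * e \<theta> * dphi c (e \<theta>)) = (- ((norm (A \<theta>))^2) * sin (\<eta> \<theta> - \<eta> \<theta>0))"
    proof -
      define \<alpha> where "\<alpha> = Im (Ln (A \<theta>))"
      have "A \<theta> = exp (of_real (Re (Ln (A \<theta>))) + \<i> * of_real \<alpha>)"
        using A0[of \<theta>] unfolding \<alpha>_def by (metis complex_eq exp_Ln)
      then have A: "A \<theta> = of_real (norm (A \<theta>)) * exp (\<i> * of_real \<alpha>)"
        using A0[of \<theta>] by (simp add: exp_add exp_of_real)
      have "dphi c (e \<theta>) = (A \<theta> / e \<theta>)^2"
        by (simp add: dphi_def A_def u_def mult_ac)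
      then have "- \<i> * e \<theta> * dphi c (e \<theta>) = - \<i> * ((A \<theta>)^2 * inverse (e \<theta>))"
        using e[of \<theta>] by (auto simp: power2_eq_square field_simps)
      also have "(A \<theta>)^2 = of_real ((norm (A \<theta>))^2) * exp (2 * (\<i> * of_real \<alpha>))"
        by (subst A) (simp add: power_mult_distrib exp_double)
      also have "inverse (e \<theta>) = exp (\<i> * of_real \<theta>)"
        by (simp add: e_def exp_minus)
      finally have *: "- \<i> * e \<theta> * dphi c (e \<theta>) =
          - \<i> * (of_real ((norm (A \<theta>))^2) * exp (\<i> * of_real (\<eta> \<theta>)))"
        by (simp add: \<eta>_def \<alpha>_def[symmetric] mult.assoc exp_add[symmetric] algebra_simps)
      show ?thesis
        unfolding * by (simp add: a_def inner_complex_def Re_exp Im_exp sin_diff algebra_simps)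
    qed
    ultimately show ?thesis by (simp add: has_real_derivative_iff_has_vector_derivative)
  qed
  have "a \<bullet> phi c w \<le> a \<bullet> phi c w0" if w: "w \<in> sphere 0 1" for w
  proof -
    obtain \<theta>1 where \<theta>1: "\<theta>1 \<in> {0..<2*pi}" "w = e \<theta>1"
      using sphere_exp_circle[OF w] by (auto simp: e_def)
    define \<theta> where "\<theta> = (if \<theta>0 \<le> \<theta>1 then \<theta>1 else \<theta>1 + 2 * pi)"
    have "F \<theta> \<le> F \<theta>0"
    proof (rule height_le_if_angle_mono[OF F' _ mono \<eta>2pi])
      show "\<theta>0 \<le> \<theta>" "\<theta> \<le> \<theta>0 + 2 * pi" using \<theta>0(1) \<theta>1(1) by (auto simp: \<theta>_def)
    qed (simp_all add: F_def e2pi)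
    then show ?thesis using \<theta>0(2) \<theta>1(2) by (simp add: F_def \<theta>_def e2pi split: if_splits)
  qed
  moreover have "a \<noteq> 0" by (simp add: a_def)
  ultimately show ?thesis by blast
qed

lemma convex_droplet:
  assumes "3 * c^4 + 14 * c^2 \<le> 1"
  shows "convex (droplet (Omega c))"
  using compact_droplet[OF c] zero_interior_droplet[OF c]
proof (rule convex_if_supported_at_frontier)
  fix x assume "x \<in> frontier (droplet (Omega c))"
  then show "\<exists>a. a \<noteq> 0 \<and> (\<forall>y\<in>frontier (droplet (Omega c)). a \<bullet> y \<le> a \<bullet> x)"
    using droplet_support[OF assms] by (auto simp: frontier_droplet[OF c])
qed

end

section \<open>The threshold \<open>c1\<close>\<close>

lemma c1_bounds: "0.265 \<le> sqrt (6 * sqrt 13 - 21) / 3" "sqrt (6 * sqrt 13 - 21) / 3 < 0.266"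
proof -
  \<comment> \<open>The bound on \<open>sqrt 13\<close> is just fine enough:
    \<open>0.795 = 3 * 0.265\<close>, and \<open>0.795^2 = 0.632025\<close> is below
    \<open>6 * 3.6054 - 21 = 0.6324\<close>.\<close>
  have "3.6054 \<le> sqrt 13" by (rule real_le_rsqrt) (simp add: power2_eq_square)
  then have "0.795 \<le> sqrt (6 * sqrt 13 - 21)"
    by (intro real_le_rsqrt) (simp add: power2_eq_square)
  then show "0.265 \<le> sqrt (6 * sqrt 13 - 21) / 3" by simp
  have "sqrt 13 < 3.606" by (rule real_less_lsqrt) (simp_all add: power2_eq_square)
  then have "sqrt (6 * sqrt 13 - 21) < 0.798"
    by (intro real_less_lsqrt) (simp_all add: power2_eq_square)
  then show "sqrt (6 * sqrt 13 - 21) / 3 < 0.266" by simp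
qed

text \<open>The square of the bound on \<open>c\<close> is the positive root of
  \<open>3 * x^2 + 14 * x = 1\<close>. Completing the square turns the claim into
  \<open>(3 * c^2 + 7)^2 \<le> 52\<close>.\<close>

lemma curvature_condition_if_le_c1:
  fixes c :: real
  assumes "0 < c" "c \<le> sqrt (6 * sqrt 13 - 21) / 3"
  shows "3 * c^4 + 14 * c^2 \<le> 1"
proof -
  have "3 * c \<le> sqrt (6 * sqrt 13 - 21)" using assms(2) by simp
  then have "(3 * c)^2 \<le> 6 * sqrt 13 - 21"
    using assms(1) by (metis less_eq_real_def mult_nonneg_nonneg real_sqrt_le_iff real_sqrt_abs2 zero_le_numeral real_sqrt_unique power2_eq_square)
  then have "3 * c^2 + 7 \<le> 2 * sqrt 13" by (simp add: power_mult_distrib)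
  then have "(3 * c^2 + 7)^2 \<le> (2 * sqrt 13)^2" by (intro power_mono) auto
  then show ?thesis by (simp add: power_mult_distrib power2_sum algebra_simps flip: power_mult)
qed

theorem theorem4p1:
  fixes c :: real
  assumes "0 < c" and "c < 1 / 3"
  defines "K \<equiv> droplet (Omega c)"
    and "p \<equiv> 1 - c^4"
    and "\<tau> \<equiv> 6 * c^4 + 2"
    and "c1 \<equiv> sqrt (6 * sqrt 13 - 21) / 3"
  shows "univalent_on (phi c) (ball 0 1) \<and> to_sphere (phi c) 0 = None \<and>
    exterior_domain (Omega c) \<and>
    frontier K = phi c ` sphere 0 1 \<and>
    (\<forall>w\<in>cball 0 1. G c (to_sphere (phi c) w) = G_hat c w) \<and>
    (\<exists>L \<gamma>. arclength_boundary K L \<gamma>) \<and>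
    (\<forall>L \<gamma> s. arclength_boundary K L \<gamma> \<longrightarrow>
       G c (Some (\<gamma> s)) =
         of_real p * cnj (\<gamma> s) + \<i> * of_real \<tau> * cnj (vector_derivative \<gamma> (at s))) \<and>
    0.265 \<le> c1 \<and> c1 < 0.266 \<and>
    (c \<le> c1 \<longrightarrow> convex K)"
proof (intro conjI allI impI ballI)
  note c = assms(1,2)
  show "univalent_on (phi c) (ball 0 1)" by (rule univalent_phi[OF c])
  show "to_sphere (phi c) 0 = None" by (simp add: to_sphere_def is_pole_phi_0[OF c])
  show "exterior_domain (Omega c)" by (rule exterior_Omega[OF c])
  show "frontier K = phi c ` sphere 0 1" unfolding K_def by (rule frontier_droplet[OF c])
  show "G c (to_sphere (phi c) w) = G_hat c w" if "w \<in> cball 0 1" for w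
    by (rule G_to_sphere[OF c that])
  show "\<exists>L \<gamma>. arclength_boundary K L \<gamma>" unfolding K_def by (rule exists_arclength_boundary[OF c])
  show "0.265 \<le> c1" "c1 < 0.266" unfolding c1_def by (rule c1_bounds)+
  show "convex K" if "c \<le> c1"
    using that unfolding K_def c1_def
    by (intro convex_droplet[OF c] curvature_condition_if_le_c1[OF c(1)])
  fix L \<gamma> s
  assume "arclength_boundary K L \<gamma>"
  then obtain w where w: "w \<in> sphere 0 1" "\<gamma> s = phi c w"
    "vector_derivative \<gamma> (at s) = - \<i> * w * dphi c w / of_real (norm (dphi c w))"
    unfolding K_def by (rule arclength_boundary_tangent[OF c])
  have "to_sphere (phi c) w = Some (\<gamma> s)"
    using sphere_radius[OF c w(1)] by (simp add: to_sphere_phi[OF c] w(2))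
  then have "G c (Some (\<gamma> s)) = G_hat c w"
    using G_to_sphere[OF c, of w] w(1) by auto
  then show "G c (Some (\<gamma> s)) =
      of_real p * cnj (\<gamma> s) + \<i> * of_real \<tau> * cnj (vector_derivative \<gamma> (at s))"
    by (simp only: G_hat_boundary[OF c w(1)] w(2,3) p_def \<tau>_def)
qed

end
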